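(* For every positive integer $n$ and every even positive integer $m=2k$, $$N(O(2n+1),m)=2\binom{n+m/2}{m/2}.$$
   Context: $O(N)$ is the group of real $N\times N$ orthogonal matrices. $N(G,m)$ denotes the number of conjugacy classes of $G$ (under conjugation by elements of $G$) contained in $\{x\in G: x^m=1\}$. *)

theory Defs
  imports "HOL-Algebra.Group_Action" "Jordan_Normal_Form.Matrix"
begin

definition orthogonal_group :: "nat \<Rightarrow> real mat monoid" where
  "orthogonal_group N =
     \<lparr>carrier = {A \<in> carrier_mat N N. A * A\<^sup>T = 1\<^sub>m N \<and> A\<^sup>T * A = 1\<^sub>m N},
      monoid.mult = (*), one = 1\<^sub>m N\<rparr>"

lemma orthogonal_group_simps [simp]:
  "monoid.mult (orthogonal_group N) = (*)"
  "one (orthogonal_group N) = 1\<^sub>m N"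
  by (simp_all add: orthogonal_group_def)

lemma carrier_orthogonal_group:
  "carrier (orthogonal_group N) =
     {A \<in> carrier_mat N N. A * A\<^sup>T = 1\<^sub>m N \<and> A\<^sup>T * A = 1\<^sub>m N}"
  by (simp add: orthogonal_group_def)

lemma group_orthogonal_group: "group (orthogonal_group N)"
proof (rule groupI)
  fix A B
  assume "A \<in> carrier (orthogonal_group N)" "B \<in> carrier (orthogonal_group N)"
  then have A: "A \<in> carrier_mat N N" "A * A\<^sup>T = 1\<^sub>m N" "A\<^sup>T * A = 1\<^sub>m N"
    and B: "B \<in> carrier_mat N N" "B * B\<^sup>T = 1\<^sub>m N" "B\<^sup>T * B = 1\<^sub>m N"
    by (auto simp: carrier_orthogonal_group)
  have t: "(A * B)\<^sup>T = B\<^sup>T * A\<^sup>T" by (rule transpose_mult[OF A(1) B(1)])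
  have "A * B * (B\<^sup>T * A\<^sup>T) = A * (B * B\<^sup>T) * A\<^sup>T"
    using A(1) B(1) by (simp add: assoc_mult_mat[of _ N N _ N _ N] mult_carrier_mat[of _ N N _ N])
  moreover have "B\<^sup>T * A\<^sup>T * (A * B) = B\<^sup>T * (A\<^sup>T * A) * B"
    using A(1) B(1) by (simp add: assoc_mult_mat[of _ N N _ N _ N] mult_carrier_mat[of _ N N _ N])
  ultimately show "A \<otimes>\<^bsub>orthogonal_group N\<^esub> B \<in> carrier (orthogonal_group N)"
    using A B by (simp add: carrier_orthogonal_group t)
next
  fix A assume "A \<in> carrier (orthogonal_group N)"
  then show "\<exists>B\<in>carrier (orthogonal_group N). B \<otimes>\<^bsub>orthogonal_group N\<^esub> A = \<one>\<^bsub>orthogonal_group N\<^esub>"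
    by (intro bexI[of _ "A\<^sup>T"]) (auto simp: carrier_orthogonal_group)
qed (auto simp: carrier_orthogonal_group)

definition conjugacy_classes :: "('a, 'b) monoid_scheme \<Rightarrow> 'a set set" where
  "conjugacy_classes G =
     orbits G (carrier G) (\<lambda>g. \<lambda>h\<in>carrier G. g \<otimes>\<^bsub>G\<^esub> h \<otimes>\<^bsub>G\<^esub> inv\<^bsub>G\<^esub> g)"

text \<open>Since \<open>card\<close> is \<open>0\<close> on infinite sets, a nonzero value of \<open>num_conjugacy_classes\<close> also says that
  there are only finitely many such classes.\<close>

definition num_conjugacy_classes :: "('a, 'b) monoid_scheme \<Rightarrow> nat \<Rightarrow> nat" where
  "num_conjugacy_classes G m =
     card {C \<in> conjugacy_classes G. C \<subseteq> {x \<in> carrier G. x [^]\<^bsub>G\<^esub> m = \<one>\<^bsub>G\<^esub>}}"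

end

(* Two real orthogonal matrices with the same characteristic polynomial are conjugate in O(N): a common
   complex root gives both of them the same diagonal block (a sign, or a plane rotation spanned by the
   real and imaginary parts of an eigenvector) on an invariant subspace, whose orthogonal complement is
   again invariant, and cancelling the block's factor allows induction on N.  So the conjugacy classes of
   solutions of A^(2k) = 1 correspond to their characteristic polynomials, which are the products of
   factors x - 1, x + 1 and (x - w)(x - cnj w) with w = exp(i pi j / k).  In odd dimension 2n + 1 exactly
   one of x - 1, x + 1 occurs to an odd power; taking out one such factor leaves a product of n factors
   from the k + 1 quadratics with 0 <= j <= k, because (x - 1)^2 and (x + 1)^2 are the cases j = 0, k.
   Root multiplicities recover the exponents, which leaves 2 * binom(n + k, k) polynomials. *)

theory Submission
  imports Defs "Jordan_Normal_Form.Char_Poly"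
begin

section \<open>Orthogonal matrices and orthonormal systems\<close>

abbreviation orth :: "nat \<Rightarrow> real mat set" where
  "orth N \<equiv> carrier (orthogonal_group N)"

text \<open>A one-sided inverse of a square matrix is two-sided, so one of the two defining
  equations is enough.\<close>

lemma orthI: "A \<in> carrier_mat N N \<Longrightarrow> A\<^sup>T * A = 1\<^sub>m N \<Longrightarrow> A \<in> orth N"
  using mat_mult_left_right_inverse[of "A\<^sup>T" N A] by (auto simp: carrier_orthogonal_group)

lemma orthD:
  assumes "A \<in> orth N"
  shows "A \<in> carrier_mat N N" "A * A\<^sup>T = 1\<^sub>m N" "A\<^sup>T * A = 1\<^sub>m N" "A\<^sup>T \<in> orth N"
  using assms by (auto simp: carrier_orthogonal_group)

lemma orth_mult: "A \<in> orth N \<Longrightarrow> B \<in> orth N \<Longrightarrow> A * B \<in> orth N"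
  using monoid.m_closed[OF group.is_monoid[OF group_orthogonal_group[of N]]] by simp

lemma orth_scalar_prod:
  assumes "A \<in> orth N" "v \<in> carrier_vec N" "w \<in> carrier_vec N"
  shows "(A *\<^sub>v v) \<bullet> (A *\<^sub>v w) = v \<bullet> w"
proof -
  note A = orthD[OF assms(1)]
  have "(A *\<^sub>v v) \<bullet> (A *\<^sub>v w) = v \<bullet> (A\<^sup>T *\<^sub>v (A *\<^sub>v w))"
    using transpose_vec_mult_scalar[of A N N v "A *\<^sub>v w"] A assms
    by (metis comm_scalar_prod mult_mat_vec_carrier transpose_carrier_mat)
  also have "A\<^sup>T *\<^sub>v (A *\<^sub>v w) = (A\<^sup>T * A) *\<^sub>v w"
    using A assms by (intro assoc_mult_mat_vec[symmetric]) auto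
  finally show ?thesis using A assms by simp
qed

section \<open>Orthonormal systems and their completion to bases\<close>

definition orthonormal :: "nat \<Rightarrow> real vec list \<Rightarrow> bool" where
  "orthonormal N us \<longleftrightarrow> set us \<subseteq> carrier_vec N \<and>
     (\<forall>i<length us. \<forall>j<length us. us ! i \<bullet> us ! j = (if i = j then 1 else 0))"

lemma scalar_prod_self_pos: "(v :: real vec) \<in> carrier_vec N \<Longrightarrow> v \<noteq> 0\<^sub>v N \<Longrightarrow> v \<bullet> v > 0"
  using conjugate_square_greater_0_vec[of v N] by simp

lemma normalize_vec:
  fixes v :: "real vec"
  assumes "v \<in> carrier_vec N" "v \<noteq> 0\<^sub>v N"
  shows "(1 / sqrt (v \<bullet> v) \<cdot>\<^sub>v v) \<bullet> (1 / sqrt (v \<bullet> v) \<cdot>\<^sub>v v) = 1"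
  using scalar_prod_self_pos[OF assms] assms by simp

text \<open>Padding the vectors with zero rows gives a singular square matrix. A nonzero kernel
  vector is orthogonal to every row, hence to all of \<open>us\<close>, and only has to be
  normalised.\<close>

lemma orthonormal_extend:
  assumes us: "orthonormal N us" and less: "length us < N"
  shows "\<exists>v. orthonormal N (us @ [v])"
proof -
  define W where "W = mat_of_rows N (us @ replicate (N - length us) (0\<^sub>v N))"
  have W: "W \<in> carrier_mat N N" using less mat_of_rows_carrier(1)[of N "us @ replicate (N - length us) (0\<^sub>v N)"]
    by (simp add: W_def)
  have usc: "us ! i \<in> carrier_vec N" if "i < length us" for i
    using us that by (auto simp: orthonormal_def)
  have rW: "row W i = us ! i" if "i < length us" for i
    unfolding W_def using that less usc[OF that] by (subst mat_of_rows_row) (auto simp: nth_append)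
  \<comment> \<open>Row \<open>length us\<close> is the first padding row, which exists because
    \<open>length us < N\<close>. Since it vanishes, this unit vector is a kernel vector of the
    transpose.\<close>
  have "W\<^sup>T *\<^sub>v unit_vec N (length us) = col W\<^sup>T (length us)"
    using W less by (intro eq_vecI) auto
  also have "\<dots> = row W (length us)"
    using W less by simp
  also have "\<dots> = 0\<^sub>v N"
    unfolding W_def using less by (subst mat_of_rows_row) (auto simp: nth_append)
  finally have "det W\<^sup>T = 0"
    using W less by (subst det_0_iff_vec_prod_zero[of _ N]) (auto intro!: exI[of _ "unit_vec N (length us)"])
  then have "det W = 0" using det_transpose[OF W] by simp
  then obtain v where v: "v \<in> carrier_vec N" "v \<noteq> 0\<^sub>v N" "W *\<^sub>v v = 0\<^sub>v N"
    using det_0_iff_vec_prod_zero[OF W] by blast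
  have "us ! i \<bullet> v = 0" if "i < length us" for i
  proof -
    have "(W *\<^sub>v v) $ i = 0" using v less that by simp
    then show ?thesis using rW[OF that] W less that by simp
  qed
  then have uv: "us ! i \<bullet> v = 0" "v \<bullet> us ! i = 0" if "i < length us" for i
    using that comm_scalar_prod[OF v(1) usc[OF that]] by auto
  have "orthonormal N (us @ [1 / sqrt (v \<bullet> v) \<cdot>\<^sub>v v])"
    unfolding orthonormal_def
  proof (intro conjI allI impI)
    show "set (us @ [1 / sqrt (v \<bullet> v) \<cdot>\<^sub>v v]) \<subseteq> carrier_vec N"
      using us v by (auto simp: orthonormal_def)
    fix i j
    assume "i < length (us @ [1 / sqrt (v \<bullet> v) \<cdot>\<^sub>v v])" "j < length (us @ [1 / sqrt (v \<bullet> v) \<cdot>\<^sub>v v])"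
    then show "(us @ [1 / sqrt (v \<bullet> v) \<cdot>\<^sub>v v]) ! i \<bullet> (us @ [1 / sqrt (v \<bullet> v) \<cdot>\<^sub>v v]) ! j = (if i = j then 1 else 0)"
      using us uv normalize_vec[OF v(1,2)] usc v(1) by (auto simp: orthonormal_def nth_append less_Suc_eq)
  qed
  then show ?thesis by blast
qed

lemma orthonormal_complete:
  assumes "orthonormal N us" "length us \<le> N"
  shows "\<exists>ws. orthonormal N (us @ ws) \<and> length (us @ ws) = N"
  using assms
proof (induction "N - length us" arbitrary: us)
  case 0
  then show ?case by (intro exI[of _ "[]"]) auto
next
  case (Suc d)
  then obtain v where v: "orthonormal N (us @ [v])" using orthonormal_extend[of N us] by force
  obtain ws where "orthonormal N ((us @ [v]) @ ws)" "length ((us @ [v]) @ ws) = N"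
    using Suc.hyps(1)[OF _ v] Suc.hyps(2) by force
  then show ?case by (intro exI[of _ "v # ws"]) simp
qed

lemma mat_of_cols_orth:
  assumes "orthonormal N ws" "length ws = N"
  shows "mat_of_cols N ws \<in> orth N"
proof (rule orthI)
  show "mat_of_cols N ws \<in> carrier_mat N N" using assms(2) mat_of_cols_carrier(1)[of N ws] by simp
  show "(mat_of_cols N ws)\<^sup>T * mat_of_cols N ws = 1\<^sub>m N"
    using assms by (intro eq_matI) (auto simp: orthonormal_def subset_iff)
qed

text \<open>Matrix form of the fact that the orthogonal complement of an invariant subspace is
  invariant. In the product of the transpose with the block matrix, the upper right block gives
  \<open>R\<^sup>T * X = 0\<close>, so \<open>X = 0\<close> because \<open>R\<close> is invertible;
  the lower right block then reduces to \<open>Y\<^sup>T * Y = 1\<close>.\<close>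

lemma orth_four_block_upper:
  assumes R: "R \<in> orth d" and X: "X \<in> carrier_mat d e" and Y: "Y \<in> carrier_mat e e"
    and B: "four_block_mat R X (0\<^sub>m e d) Y \<in> orth (d + e)"
  shows "X = 0\<^sub>m d e" "Y \<in> orth e"
proof -
  note R' = orthD[OF R]
  have "1\<^sub>m (d + e) = (four_block_mat R X (0\<^sub>m e d) Y)\<^sup>T * four_block_mat R X (0\<^sub>m e d) Y"
    using orthD[OF B] by simp
  also have "(four_block_mat R X (0\<^sub>m e d) Y)\<^sup>T = four_block_mat R\<^sup>T (0\<^sub>m d e) X\<^sup>T Y\<^sup>T"
    using R' X Y by (subst transpose_four_block_mat[of _ d d _ e _ e]) auto
  also have "\<dots> * four_block_mat R X (0\<^sub>m e d) Y
      = four_block_mat (R\<^sup>T * R + 0\<^sub>m d e * 0\<^sub>m e d) (R\<^sup>T * X + 0\<^sub>m d e * Y)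
          (X\<^sup>T * R + Y\<^sup>T * 0\<^sub>m e d) (X\<^sup>T * X + Y\<^sup>T * Y)"
    using R' X Y by (intro mult_four_block_mat) auto
  finally have eq: "four_block_mat (R\<^sup>T * R + 0\<^sub>m d e * 0\<^sub>m e d) (R\<^sup>T * X + 0\<^sub>m d e * Y)
          (X\<^sup>T * R + Y\<^sup>T * 0\<^sub>m e d) (X\<^sup>T * X + Y\<^sup>T * Y) = four_block_mat (1\<^sub>m d) (0\<^sub>m d e) (0\<^sub>m e d) (1\<^sub>m e)"
    by simp
  have RX: "R\<^sup>T * X = 0\<^sub>m d e"
  proof (rule eq_matI)
    fix i j assume ij: "i < dim_row (0\<^sub>m d e)" "j < dim_col (0\<^sub>m d e)"
    have "four_block_mat (R\<^sup>T * R + 0\<^sub>m d e * 0\<^sub>m e d) (R\<^sup>T * X + 0\<^sub>m d e * Y)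
          (X\<^sup>T * R + Y\<^sup>T * 0\<^sub>m e d) (X\<^sup>T * X + Y\<^sup>T * Y) $$ (i, d + j) = 0"
      unfolding eq using ij by simp
    then show "(R\<^sup>T * X) $$ (i, j) = 0\<^sub>m d e $$ (i, j)" using ij R' X Y by (simp add: scalar_prod_def)
  qed (use R' X in auto)
  have "X = (R * R\<^sup>T) * X" using R' X by simp
  also have "\<dots> = R * (R\<^sup>T * X)" using R' X by (intro assoc_mult_mat) auto
  finally show X0: "X = 0\<^sub>m d e" using RX R' by simp
  have "Y\<^sup>T * Y = 1\<^sub>m e"
  proof (rule eq_matI)
    fix i j assume ij: "i < dim_row (1\<^sub>m e)" "j < dim_col (1\<^sub>m e)"
    have "four_block_mat (R\<^sup>T * R + 0\<^sub>m d e * 0\<^sub>m e d) (R\<^sup>T * X + 0\<^sub>m d e * Y)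
          (X\<^sup>T * R + Y\<^sup>T * 0\<^sub>m e d) (X\<^sup>T * X + Y\<^sup>T * Y) $$ (d + i, d + j) = (if i = j then 1 else 0)"
      unfolding eq using ij by simp
    then show "(Y\<^sup>T * Y) $$ (i, j) = 1\<^sub>m e $$ (i, j)" using ij R' X Y by (simp add: X0)
  qed (use Y in auto)
  then show "Y \<in> orth e" using Y by (intro orthI)
qed

section \<open>Block diagonal matrices and characteristic polynomials\<close>

text \<open>Taken over the complex numbers so that every matrix of positive size has a root to split
  off.\<close>

definition complex_char_poly :: "real mat \<Rightarrow> complex poly" where
  "complex_char_poly A = char_poly (map_mat complex_of_real A)"

definition diag2 :: "real mat \<Rightarrow> real mat \<Rightarrow> real mat" where
  "diag2 A B = four_block_mat A (0\<^sub>m (dim_row A) (dim_col B)) (0\<^sub>m (dim_row B) (dim_col A)) B"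

lemma diag2_carrier [simp]:
  "A \<in> carrier_mat d d \<Longrightarrow> B \<in> carrier_mat e e \<Longrightarrow> diag2 A B \<in> carrier_mat (d + e) (d + e)"
  by (simp add: diag2_def)

lemma diag2_mult:
  assumes "A \<in> carrier_mat d d" "B \<in> carrier_mat e e" "A' \<in> carrier_mat d d" "B' \<in> carrier_mat e e"
  shows "diag2 A B * diag2 A' B' = diag2 (A * A') (B * B')"
  unfolding diag2_def using assms by (subst mult_four_block_mat[of _ d d _ e _ e _ _ d _ e]) auto

lemma diag2_transpose:
  assumes "A \<in> carrier_mat d d" "B \<in> carrier_mat e e"
  shows "(diag2 A B)\<^sup>T = diag2 A\<^sup>T B\<^sup>T"
  unfolding diag2_def using assms by (subst transpose_four_block_mat[of _ d d _ e _ e]) auto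

lemma diag2_one: "diag2 (1\<^sub>m d) (1\<^sub>m e) = 1\<^sub>m (d + e)"
  by (simp add: diag2_def)

lemma diag2_orth: "A \<in> orth d \<Longrightarrow> B \<in> orth e \<Longrightarrow> diag2 A B \<in> orth (d + e)"
  using orthD[of A d] orthD[of B e]
  by (intro orthI) (auto simp: diag2_transpose[of _ d _ e] diag2_mult[of _ d _ e] diag2_one)

lemma diag2_pow:
  assumes "A \<in> carrier_mat d d" "B \<in> carrier_mat e e"
  shows "diag2 A B ^\<^sub>m m = diag2 (A ^\<^sub>m m) (B ^\<^sub>m m)"
  using pow_four_block_mat[OF assms, of m] assms by (simp add: diag2_def)

text \<open>Passes the equation \<open>A ^ m = 1\<close> on to the lower block, where the induction
  continues.\<close>

lemma diag2_eq_one: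
  assumes "A \<in> carrier_mat d d" "B \<in> carrier_mat e e" "diag2 A B = 1\<^sub>m (d + e)"
  shows "B = 1\<^sub>m e"
proof (rule eq_matI)
  fix i j assume ij: "i < dim_row (1\<^sub>m e)" "j < dim_col (1\<^sub>m e)"
  have "diag2 A B $$ (d + i, d + j) = (1\<^sub>m (d + e)) $$ (d + i, d + j)"
    using assms(3) by simp
  then show "B $$ (i, j) = 1\<^sub>m e $$ (i, j)" using ij assms(1,2) by (simp add: diag2_def)
qed (use assms in auto)

lemma char_poly_diag:
  fixes A B :: "'a :: field mat"
  assumes "A \<in> carrier_mat d d" "B \<in> carrier_mat e e"
  shows "char_poly (four_block_mat A (0\<^sub>m d e) (0\<^sub>m e d) B) = char_poly A * char_poly B"
proof -
  have "char_poly_matrix (four_block_mat A (0\<^sub>m d e) (0\<^sub>m e d) B)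
      = four_block_mat (char_poly_matrix A) (0\<^sub>m d e) (0\<^sub>m e d) (char_poly_matrix B)"
    using assms by (intro eq_matI) (auto simp: char_poly_matrix_def)
  then show ?thesis
    unfolding char_poly_def using assms
    by (simp add: det_four_block_mat_lower_left_zero[of _ d _ e])
qed

lemma complex_char_poly_diag2:
  assumes "A \<in> carrier_mat d d" "B \<in> carrier_mat e e"
  shows "complex_char_poly (diag2 A B) = complex_char_poly A * complex_char_poly B"
proof -
  have "map_mat complex_of_real (diag2 A B)
      = four_block_mat (map_mat of_real A) (0\<^sub>m d e) (0\<^sub>m e d) (map_mat of_real B)"
    using assms by (intro eq_matI) (auto simp: diag2_def)
  then show ?thesis using assms by (simp add: complex_char_poly_def char_poly_diag)
qed

lemma complex_char_poly_degree:
  "A \<in> carrier_mat N N \<Longrightarrow> degree (complex_char_poly A) = N"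
  "A \<in> carrier_mat N N \<Longrightarrow> complex_char_poly A \<noteq> 0"
  using degree_monic_char_poly[of "map_mat complex_of_real A" N]
  by (auto simp: complex_char_poly_def)

lemma complex_char_poly_conj:
  assumes Q: "Q \<in> orth N" and A: "A \<in> carrier_mat N N"
  shows "complex_char_poly (Q * A * Q\<^sup>T) = complex_char_poly A"
proof -
  note Q' = orthD[OF Q]
  let ?h = "map_mat complex_of_real"
  have "similar_mat (?h (Q * A * Q\<^sup>T)) (?h A)"
  proof (rule similar_matI)
    show "?h Q * ?h Q\<^sup>T = 1\<^sub>m N" "?h Q\<^sup>T * ?h Q = 1\<^sub>m N"
      using of_real_hom.mat_hom_mult[of Q N N "Q\<^sup>T" N, where ?'a = complex]
        of_real_hom.mat_hom_mult[of "Q\<^sup>T" N N "Q" N, where ?'a = complex] Q'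
      by (auto simp: of_real_hom.mat_hom_one)
    show "?h (Q * A * Q\<^sup>T) = ?h Q * ?h A * ?h Q\<^sup>T"
      using Q' A by (simp add: of_real_hom.mat_hom_mult[of _ N N _ N])
  qed (use Q' A in auto)
  then show ?thesis unfolding complex_char_poly_def by (rule char_poly_similar)
qed

section \<open>Plane rotations and the real blocks belonging to eigenvalues\<close>

text \<open>The real matrix of multiplication by \<open>cnj z\<close>. With this choice of sign the
  columns describe a real map on the parts of an eigenvector \<open>x + i y\<close> for
  \<open>z = a + i b\<close>: \<open>x\<close> goes to \<open>a x - b y\<close> and \<open>y\<close>
  to \<open>b x + a y\<close>.\<close>

definition rot :: "complex \<Rightarrow> real mat" where
  "rot z = mat 2 2 (\<lambda>(i, j). if i = j then Re z else if i < j then Im z else - Im z)"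

lemma rot_carrier [simp]: "rot z \<in> carrier_mat 2 2" "dim_row (rot z) = 2" "dim_col (rot z) = 2"
  by (simp_all add: rot_def)

lemma rot_mult: "rot z * rot w = rot (z * w)"
  by (intro eq_matI) (auto simp: rot_def scalar_prod_def numeral_2_eq_2 less_Suc_eq)

lemma rot_one: "rot 1 = 1\<^sub>m 2"
  by (intro eq_matI) (auto simp: rot_def)

lemma rot_pow: "rot z ^\<^sub>m m = rot (z ^ m)"
  by (induction m) (simp_all add: rot_one rot_mult mult.commute)

lemma rot_transpose: "(rot z)\<^sup>T = rot (cnj z)"
  by (intro eq_matI) (auto simp: rot_def)

lemma rot_orth:
  assumes "cmod z = 1"
  shows "rot z \<in> orth 2"
proof (rule orthI)
  have "cnj z * z = 1" using assms by (simp add: complex_norm_square[symmetric] mult.commute)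
  then show "(rot z)\<^sup>T * rot z = 1\<^sub>m 2" by (simp add: rot_transpose rot_mult rot_one)
qed simp

lemma det_2:
  assumes "A \<in> carrier_mat 2 2"
  shows "det A = A $$ (0, 0) * A $$ (1, 1) - A $$ (0, 1) * A $$ (1, 0)"
proof -
  have "det (mat_delete A 0 j) = mat_delete A 0 j $$ (0, 0)" for j
    using mat_delete_carrier[OF assms, of 0 j] by (intro det_single) simp
  then show ?thesis
    using assms
    by (subst laplace_expansion_row[OF assms, of 0])
      (simp_all add: cofactor_def mat_delete_def numeral_2_eq_2)
qed

lemma complex_char_poly_rot: "complex_char_poly (rot z) = [:- z, 1:] * [:- cnj z, 1:]"
proof -
  have "complex_char_poly (rot z) = [:- Re z, 1:] * [:- Re z, 1:] + [:(Im z)\<^sup>2:]"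
    unfolding complex_char_poly_def char_poly_def
    by (subst det_2) (auto simp: char_poly_matrix_def rot_def power2_eq_square)
  then show ?thesis
    by (simp add: complex_eq_iff power2_eq_square)
qed

lemma complex_char_poly_single: "complex_char_poly (mat 1 1 (\<lambda>_. a)) = [:- of_real a, 1:]"
  unfolding complex_char_poly_def char_poly_def
  by (subst det_single) (auto simp: char_poly_matrix_def)

text \<open>The matrix of an orthogonal map on the smallest real invariant subspace belonging to the
  eigenvalue \<open>z\<close>: as \<open>cmod z = 1\<close>, the condition \<open>z\<^sup>2 = 1\<close> says that \<open>z\<close> is real.\<close>

definition root_block :: "complex \<Rightarrow> real mat" where
  "root_block z = (if z\<^sup>2 = 1 then mat 1 1 (\<lambda>_. Re z) else rot z)"

lemma root_block_dim: "dim_row (root_block z) = (if z\<^sup>2 = 1 then 1 else 2)"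
  by (simp add: root_block_def)

lemma complex_char_poly_root_block:
  "complex_char_poly (root_block z)
     = (if z\<^sup>2 = 1 then [:- z, 1:] else [:- z, 1:] * [:- cnj z, 1:])"
proof (cases "z\<^sup>2 = 1")
  case True
  then have "z = 1 \<or> z = -1" by (simp add: power2_eq_1_iff)
  then have "complex_of_real (Re z) = z" by auto
  then show ?thesis using True by (simp add: root_block_def complex_char_poly_single del: One_nat_def)
qed (simp add: root_block_def complex_char_poly_rot)

lemma orthonormal_single: "u \<in> carrier_vec N \<Longrightarrow> u \<bullet> u = 1 \<Longrightarrow> orthonormal N [u]"
  by (simp add: orthonormal_def)

lemma orthonormal_pair:
  assumes "x \<in> carrier_vec N" "y \<in> carrier_vec N" "x \<bullet> x = 1" "y \<bullet> y = 1" "x \<bullet> y = 0"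
  shows "orthonormal N [x, y]"
  using assms comm_scalar_prod[of x N y]
  by (auto simp: orthonormal_def less_Suc_eq nth_Cons')

text \<open>Turns the invariance of scalar products on the span of \<open>x\<close> and
  \<open>y\<close> into equations between three real numbers.\<close>

lemma comb_scalar_prod:
  fixes x y :: "real vec"
  assumes "x \<in> carrier_vec N" "y \<in> carrier_vec N"
  shows "(a \<cdot>\<^sub>v x + b \<cdot>\<^sub>v y) \<bullet> (c \<cdot>\<^sub>v x + d \<cdot>\<^sub>v y)
     = a * c * (x \<bullet> x) + (a * d + b * c) * (x \<bullet> y) + b * d * (y \<bullet> y)"
  using assms comm_scalar_prod[of x N y]
  by (simp add: add_scalar_prod_distrib[of _ N] scalar_prod_add_distrib[of _ N] algebra_simps)

lemma root_block_orth:
  assumes "cmod z = 1"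
  shows "root_block z \<in> orth (dim_row (root_block z))"
proof (cases "z\<^sup>2 = 1")
  case True
  then have "z = 1 \<or> z = -1" by (simp add: power2_eq_1_iff)
  then have "Re z * Re z = 1" by auto
  then show ?thesis using True
    by (intro orthI) (auto simp: root_block_def scalar_prod_def intro!: eq_matI)
qed (use rot_orth[OF assms] in \<open>simp add: root_block_def\<close>)

text \<open>The real and imaginary parts \<open>x\<close>, \<open>y\<close> of a complex eigenvector
  span an invariant subspace. Invariance of the scalar product forces \<open>cmod z = 1\<close>. For
  non-real \<open>z\<close> it also makes \<open>x\<close> and \<open>y\<close> orthogonal and
  equally long, so that rescaling gives an orthonormal pair; for real \<open>z\<close> a nonzero one
  of them is a real eigenvector.\<close>

lemma orth_root:
  assumes A: "A \<in> orth N" and z: "poly (complex_char_poly A) z = 0"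
  obtains us where "orthonormal N us" "length us = dim_row (root_block z)"
    "\<And>j. j < length us \<Longrightarrow> A *\<^sub>v us ! j = mat_of_cols N us *\<^sub>v col (root_block z) j"
    "cmod z = 1"
proof -
  let ?C = "map_mat complex_of_real A"
  note A' = orthD(1)[OF A]
  note result = that
  obtain v where v: "v \<in> carrier_vec N" "v \<noteq> 0\<^sub>v N" "?C *\<^sub>v v = z \<cdot>\<^sub>v v"
    using z A' eigenvalue_root_char_poly[of ?C N z]
    by (auto simp: complex_char_poly_def eigenvalue_def eigenvector_def)
  define x where "x = map_vec Re v"
  define y where "y = map_vec Im v"
  have xy: "x \<in> carrier_vec N" "y \<in> carrier_vec N" using v by (auto simp: x_def y_def)
  define a b where "a = Re z" and "b = Im z"
  have Cv: "(\<Sum>j<N. complex_of_real (A $$ (i, j)) * v $ j) = z * v $ i" if "i < N" for i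
  proof -
    have "(?C *\<^sub>v v) $ i = (\<Sum>j<N. complex_of_real (A $$ (i, j)) * v $ j)"
      using A' v(1) that by (auto simp: scalar_prod_def atLeast0LessThan intro!: sum.cong)
    then show ?thesis using v that by simp
  qed
  have Ax: "A *\<^sub>v x = a \<cdot>\<^sub>v x + (- b) \<cdot>\<^sub>v y"
  proof (rule eq_vecI)
    fix i assume "i < dim_vec (a \<cdot>\<^sub>v x + (- b) \<cdot>\<^sub>v y)"
    then have i: "i < N" using xy by simp
    have "(A *\<^sub>v x) $ i = (\<Sum>j<N. A $$ (i, j) * Re (v $ j))"
      using A' v i by (auto simp: x_def scalar_prod_def atLeast0LessThan intro!: sum.cong)
    also have "\<dots> = Re (\<Sum>j<N. complex_of_real (A $$ (i, j)) * v $ j)" by simp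
    finally show "(A *\<^sub>v x) $ i = (a \<cdot>\<^sub>v x + (- b) \<cdot>\<^sub>v y) $ i"
      using Cv[OF i] i v xy by (simp add: x_def y_def a_def b_def)
  qed (use A' xy in auto)
  have Ay: "A *\<^sub>v y = b \<cdot>\<^sub>v x + a \<cdot>\<^sub>v y"
  proof (rule eq_vecI)
    fix i assume "i < dim_vec (b \<cdot>\<^sub>v x + a \<cdot>\<^sub>v y)"
    then have i: "i < N" using xy by simp
    have "(A *\<^sub>v y) $ i = (\<Sum>j<N. A $$ (i, j) * Im (v $ j))"
      using A' v i by (auto simp: y_def scalar_prod_def atLeast0LessThan intro!: sum.cong)
    also have "\<dots> = Im (\<Sum>j<N. complex_of_real (A $$ (i, j)) * v $ j)" by simp
    finally show "(A *\<^sub>v y) $ i = (b \<cdot>\<^sub>v x + a \<cdot>\<^sub>v y) $ i"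
      using Cv[OF i] i v xy by (simp add: x_def y_def a_def b_def)
  qed (use A' xy in auto)
  \<comment> \<open>The Gram entries of \<open>x\<close> and \<open>y\<close>. The next three
    equations equate them with the Gram entries of their images under \<open>A\<close>.\<close>
  define p q r where "p = x \<bullet> x" and "q = y \<bullet> y" and "r = x \<bullet> y"
  have p: "p = a\<^sup>2 * p - 2 * a * b * r + b\<^sup>2 * q"
    using orth_scalar_prod[OF A xy(1) xy(1)] comb_scalar_prod[OF xy, of a "-b" a "-b"]
    by (simp add: Ax p_def q_def r_def power2_eq_square algebra_simps)
  have q: "q = b\<^sup>2 * p + 2 * a * b * r + a\<^sup>2 * q"
    using orth_scalar_prod[OF A xy(2) xy(2)] comb_scalar_prod[OF xy, of b a b a]
    by (simp add: Ay p_def q_def r_def power2_eq_square algebra_simps)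
  have r: "r = a * b * (p - q) + (a\<^sup>2 - b\<^sup>2) * r"
    using orth_scalar_prod[OF A xy] comb_scalar_prod[OF xy, of a "-b" b a]
    by (simp add: Ax Ay p_def q_def r_def power2_eq_square algebra_simps)
  have nz: "x \<noteq> 0\<^sub>v N \<or> y \<noteq> 0\<^sub>v N"
  proof (rule ccontr)
    assume "\<not> ?thesis"
    then have "x $ i = 0 \<and> y $ i = 0" if "i < N" for i using that by simp
    then have "v $ i = 0" if "i < N" for i using v that by (simp add: x_def y_def complex_eq_iff)
    then show False using v by (metis eq_vecI carrier_vecD index_zero_vec)
  qed
  have pq: "p > 0 \<or> q > 0" "p \<ge> 0" "q \<ge> 0"
    using nz scalar_prod_self_pos[OF xy(1)] scalar_prod_self_pos[OF xy(2)] xy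
    by (auto simp: p_def q_def scalar_prod_def intro!: sum_nonneg)
  \<comment> \<open>Adding the equations for \<open>p\<close> and \<open>q\<close> cancels the mixed
    term, and \<open>p + q\<close> is positive.\<close>
  have "p + q = (a\<^sup>2 + b\<^sup>2) * (p + q)" using p q by (simp add: algebra_simps)
  then have ab: "a\<^sup>2 + b\<^sup>2 = 1" using pq by auto
  then have norm: "cmod z = 1" by (simp add: cmod_def a_def b_def)
  show thesis
  proof (cases "z\<^sup>2 = 1")
    case True
    then have b0: "b = 0" by (auto simp: b_def power2_eq_1_iff)
    \<comment> \<open>Here \<open>w\<close> stands for whichever of \<open>x\<close> and
      \<open>y\<close> is nonzero; as \<open>b = 0\<close>, both satisfy the eigenvector
      equation.\<close>
    have *: thesis if w: "w \<in> carrier_vec N" "w \<noteq> 0\<^sub>v N" "A *\<^sub>v w = a \<cdot>\<^sub>v w" for w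
    proof (rule result[of "[1 / sqrt (w \<bullet> w) \<cdot>\<^sub>v w]"])
      show "orthonormal N [1 / sqrt (w \<bullet> w) \<cdot>\<^sub>v w]"
        using normalize_vec[OF w(1,2)] w by (intro orthonormal_single) auto
      show "length [1 / sqrt (w \<bullet> w) \<cdot>\<^sub>v w] = dim_row (root_block z)"
        using True by (simp add: root_block_def)
      fix j assume "j < length [1 / sqrt (w \<bullet> w) \<cdot>\<^sub>v w]"
      then show "A *\<^sub>v [1 / sqrt (w \<bullet> w) \<cdot>\<^sub>v w] ! j
        = mat_of_cols N [1 / sqrt (w \<bullet> w) \<cdot>\<^sub>v w] *\<^sub>v col (root_block z) j"
        using A' w True
        by (auto simp: mult_mat_vec root_block_def a_def mat_of_cols_def scalar_prod_def intro!: eq_vecI)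
    qed (fact norm)
    show thesis
    proof (cases "x = 0\<^sub>v N")
      case True
      then show thesis using nz Ay b0 xy by (intro *[of y]) auto
    next
      case False
      then show thesis using Ax b0 xy by (intro *[of x]) auto
    qed
  next
    case False
    \<comment> \<open>\<open>Complex (p - q) (2 * r)\<close> is the bilinear square \<open>v \<bullet> v = (A *\<^sub>v v) \<bullet> (A *\<^sub>v v)\<close>.\<close>
    have "z\<^sup>2 * Complex (p - q) (2 * r) = Complex (p - q) (2 * r)"
      using p q r by (simp add: complex_eq_iff power2_eq_square a_def[symmetric] b_def[symmetric] algebra_simps)
    then have "Complex (p - q) (2 * r) = 0" using False by simp
    then have pr: "p = q" "r = 0" by (auto simp: complex_eq_iff)
    then have p0: "p > 0" using pq by auto
    \<comment> \<open>One factor normalises both vectors because \<open>p = q\<close>, and a common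
      factor leaves the formulas for their images intact.\<close>
    define c where "c = 1 / sqrt p"
    have c: "c * c * p = 1" using p0 by (simp add: c_def)
    let ?us = "[c \<cdot>\<^sub>v x, c \<cdot>\<^sub>v y]"
    show thesis
    proof (rule result[of ?us])
      show "orthonormal N ?us"
        using xy c pr by (intro orthonormal_pair) (auto simp: p_def q_def r_def)
      show "length ?us = dim_row (root_block z)" using False by (simp add: root_block_def)
      fix j assume "j < length ?us"
      then have "j = 0 \<or> j = 1" by auto
      then show "A *\<^sub>v ?us ! j = mat_of_cols N ?us *\<^sub>v col (root_block z) j"
        using False A' xy
        by (auto simp: mult_mat_vec Ax Ay root_block_def rot_def a_def b_def mat_of_cols_def scalar_prod_def
          numeral_2_eq_2 algebra_simps intro!: eq_vecI)
    qed (fact norm)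
  qed
qed

section \<open>Conjugacy in the orthogonal group\<close>

lemma orth_conj_cancel:
  assumes Q: "Q \<in> orth N" and M: "M \<in> carrier_mat N N"
  shows "Q\<^sup>T * (Q * M * Q\<^sup>T) * Q = M"
proof -
  note Q' = orthD[OF Q]
  have "Q\<^sup>T * (Q * M * Q\<^sup>T) * Q = (Q\<^sup>T * Q) * M * (Q\<^sup>T * Q)"
    using Q'(1) M by (simp add: assoc_mult_mat[of _ N N _ N _ N] mult_carrier_mat[of _ N N _ N])
  then show ?thesis using Q' M by simp
qed

text \<open>The first \<open>N\<close> vectors would already form an orthogonal matrix. Its
  transpose preserves lengths, yet it would send the next vector, which is orthogonal to all of
  them, to zero.\<close>

lemma orthonormal_length:
  assumes us: "orthonormal N us"
  shows "length us \<le> N"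
proof (rule ccontr)
  assume "\<not> ?thesis"
  then have t: "orthonormal N (take N us)" "length (take N us) = N" "N < length us"
    using us by (auto simp: orthonormal_def dest: in_set_takeD)
  let ?T = "mat_of_cols N (take N us)"
  note T = orthD[OF mat_of_cols_orth[OF t(1,2)]]
  have c: "us ! N \<in> carrier_vec N" using us t(3) by (auto simp: orthonormal_def)
  have "?T\<^sup>T *\<^sub>v (us ! N) = 0\<^sub>v N"
    using us t(3) by (intro eq_vecI) (auto simp: orthonormal_def subset_iff)
  then have "us ! N \<bullet> us ! N = 0"
    using orth_scalar_prod[OF T(4) c c] by simp
  then show False using us t(3) by (auto simp: orthonormal_def)
qed

text \<open>Completing the vectors of \<open>orth_root\<close> to an orthonormal basis makes the
  matrix block upper triangular with \<open>root_block z\<close> in the corner, and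
  \<open>orth_four_block_upper\<close> clears the remaining block. The block depends on
  \<open>z\<close> only, so two matrices with a common root receive the same one.\<close>

lemma orth_split:
  assumes A: "A \<in> orth N" and z: "poly (complex_char_poly A) z = 0"
  obtains Q e B where "N = dim_row (root_block z) + e" "Q \<in> orth N" "B \<in> orth e"
    "A = Q * diag2 (root_block z) B * Q\<^sup>T" "root_block z \<in> orth (dim_row (root_block z))"
proof -
  obtain us where us: "orthonormal N us" "length us = dim_row (root_block z)"
    "\<And>j. j < length us \<Longrightarrow> A *\<^sub>v us ! j = mat_of_cols N us *\<^sub>v col (root_block z) j"
    "cmod z = 1"
    using orth_root[OF A z] by blast
  define d where "d = dim_row (root_block z)"
  let ?R = "root_block z"
  have R: "?R \<in> orth d" using root_block_orth[OF us(4)] by (simp add: d_def)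
  note R' = orthD[OF R]
  note A' = orthD[OF A]
  have "length us \<le> N" by (rule orthonormal_length[OF us(1)])
  then obtain ws where ws: "orthonormal N (us @ ws)" "length (us @ ws) = N"
    using orthonormal_complete[OF us(1)] by blast
  define e where "e = length ws"
  have N: "N = d + e" using ws(2) us(2) by (simp add: d_def e_def)
  define Q where "Q = mat_of_cols N (us @ ws)"
  have Q: "Q \<in> orth N" unfolding Q_def by (rule mat_of_cols_orth[OF ws])
  note Q' = orthD[OF Q]
  have usc: "us ! i \<in> carrier_vec N" if "i < d" for i
    using us(1) us(2) that by (auto simp: orthonormal_def d_def)
  have wsc: "(us @ ws) ! i \<in> carrier_vec N" if "i < N" for i
    using ws that by (auto simp: orthonormal_def subset_iff simp del: set_append)
  define B where "B = Q\<^sup>T * A * Q"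
  have B: "B \<in> orth N" unfolding B_def by (intro orth_mult Q A Q'(4))
  note B' = orthD[OF B]
  \<comment> \<open>Entry \<open>(i, j)\<close> is the scalar product of basis vector
    \<open>i\<close> with the image of basis vector \<open>j\<close>. For \<open>j < d\<close> this
    image is a combination of \<open>us\<close>, and orthonormality reads off its
    coefficient.\<close>
  have B_left: "B $$ (i, j) = (if i < d then ?R $$ (i, j) else 0)" if i: "i < N" and j: "j < d" for i j
  proof -
    let ?U = "mat_of_cols N us"
    have U: "?U \<in> carrier_mat N d" using us(2) mat_of_cols_carrier(1)[of N us] by (simp add: d_def)
    have j': "j < length us" using j us(2) d_def by simp
    have colQ: "col Q k = (us @ ws) ! k" if "k < N" for k
      unfolding Q_def using that ws(2) wsc by (intro col_mat_of_cols) auto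
    have "B $$ (i, j) = row (Q\<^sup>T) i \<bullet> col (A * Q) j"
      unfolding B_def using Q' A' i j N by (subst assoc_mult_mat[of _ N N _ N _ N]) auto
    also have "col (A * Q) j = A *\<^sub>v us ! j"
      using Q' A' j N j' colQ[of j] by (subst col_mult2[of _ N N _ N]) (auto simp: nth_append)
    also have "\<dots> = ?U *\<^sub>v col ?R j" using us(3)[OF j'] .
    also have "row Q\<^sup>T i = (us @ ws) ! i" using i Q' colQ by simp
    also have "(us @ ws) ! i \<bullet> (?U *\<^sub>v col ?R j) = (?U\<^sup>T *\<^sub>v (us @ ws) ! i) \<bullet> col ?R j"
      using wsc[OF i] U R' j by (intro transpose_vec_mult_scalar[symmetric]) auto
    also have "?U\<^sup>T *\<^sub>v (us @ ws) ! i = (if i < d then unit_vec d i else 0\<^sub>v d)"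
    proof (rule eq_vecI)
      fix k assume "k < dim_vec (if i < d then unit_vec d i else 0\<^sub>v d)"
      then have k: "k < d" by (auto split: if_splits)
      have "(?U\<^sup>T *\<^sub>v (us @ ws) ! i) $ k = us ! k \<bullet> (us @ ws) ! i"
        using U k usc[OF k] us(2) by (simp add: d_def)
      also have "us ! k = (us @ ws) ! k" using k us(2) by (simp add: nth_append d_def)
      also have "(us @ ws) ! k \<bullet> (us @ ws) ! i = (if k = i then 1 else 0)"
        using ws i k N unfolding orthonormal_def by auto
      finally show "(?U\<^sup>T *\<^sub>v (us @ ws) ! i) $ k = (if i < d then unit_vec d i else 0\<^sub>v d) $ k"
        using k by auto
    qed (use U in auto)
    finally show ?thesis using R' j by auto
  qed
  define X Y where "X = mat d e (\<lambda>(i, j). B $$ (i, j + d))" and "Y = mat e e (\<lambda>(i, j). B $$ (i + d, j + d))"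
  have XY: "X \<in> carrier_mat d e" "Y \<in> carrier_mat e e" by (auto simp: X_def Y_def)
  have Bblk: "B = four_block_mat ?R X (0\<^sub>m e d) Y"
    using B' R' N by (intro eq_matI) (auto simp: B_left X_def Y_def)
  have Y: "X = 0\<^sub>m d e" "Y \<in> orth e"
    using orth_four_block_upper[OF R XY] B unfolding N Bblk by auto
  have "B = diag2 ?R Y" using Bblk Y(1) R' XY by (simp add: diag2_def)
  moreover have "A = Q * B * Q\<^sup>T"
    using orth_conj_cancel[OF Q'(4) A'(1)] by (simp add: B_def)
  ultimately show thesis using that[OF N[unfolded d_def] Q Y(2)] R by (simp add: d_def)
qed

text \<open>A common root splits the same block off both matrices. Cancelling its nonzero polynomial
  shows that the complements again have equal polynomials, and they are smaller because a block has
  positive size.\<close>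

lemma orth_conj_if_char_poly_eq:
  assumes "A \<in> orth N" "B \<in> orth N" "complex_char_poly A = complex_char_poly B"
  shows "\<exists>Q\<in>orth N. B = Q * A * Q\<^sup>T"
  using assms
proof (induction N arbitrary: A B rule: less_induct)
  case (less N)
  note A = orthD[OF less.prems(1)] and B = orthD[OF less.prems(2)]
  show ?case
  proof (cases "N = 0")
    case True
    then have "B = 1\<^sub>m N * A * (1\<^sub>m N)\<^sup>T" using A B by (intro eq_matI) auto
    then show ?thesis by (intro bexI[of _ "1\<^sub>m N"]) (auto intro: orthI)
  next
    case False
    then have "\<not> constant (poly (complex_char_poly A))"
      using complex_char_poly_degree(1)[OF A(1)] by (simp add: constant_degree)
    then obtain z where z: "poly (complex_char_poly A) z = 0"
      using fundamental_theorem_of_algebra by blast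
    let ?R = "root_block z"
    obtain Q e A' where QA: "N = dim_row ?R + e" "Q \<in> orth N" "A' \<in> orth e"
      "A = Q * diag2 ?R A' * Q\<^sup>T" "?R \<in> orth (dim_row ?R)"
      by (rule orth_split[OF less.prems(1) z])
    have "poly (complex_char_poly B) z = 0" using z less.prems(3) by simp
    then obtain P e' B' where PB0: "N = dim_row ?R + e'" "P \<in> orth N" "B' \<in> orth e'"
      "B = P * diag2 ?R B' * P\<^sup>T"
      by (rule orth_split[OF less.prems(2)])
    then have PB: "P \<in> orth N" "B' \<in> orth e" "B = P * diag2 ?R B' * P\<^sup>T" using QA(1) by auto
    define d where "d = dim_row ?R"
    have d: "N = d + e" "?R \<in> orth d" "d > 0" using QA by (auto simp: d_def root_block_def)
    note R' = orthD[OF d(2)] and A' = orthD[OF QA(3)] and B' = orthD[OF PB(2)]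
    have "complex_char_poly ?R * complex_char_poly A' = complex_char_poly ?R * complex_char_poly B'"
      using less.prems(3) complex_char_poly_diag2[OF R'(1) A'(1)] complex_char_poly_diag2[OF R'(1) B'(1)]
        complex_char_poly_conj[OF QA(2), of "diag2 ?R A'"] complex_char_poly_conj[OF PB(1), of "diag2 ?R B'"]
        QA(4) PB(3) d(1) R'(1) A'(1) B'(1) by simp
    then have "complex_char_poly A' = complex_char_poly B'"
      using complex_char_poly_degree(2)[OF R'(1)] by simp
    then obtain S where S: "S \<in> orth e" "B' = S * A' * S\<^sup>T"
      using less.IH[of e A' B'] QA(3) PB(2) d by auto
    \<comment> \<open>The conjugating matrix of the complements, extended by the identity on the
      common block. Between the two changes of basis it yields the conjugator
      \<open>P * T * Q\<^sup>T\<close>.\<close>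
    define T where "T = diag2 (1\<^sub>m d) S"
    note S' = orthD[OF S(1)]
    have T: "T \<in> orth N" unfolding T_def d(1) by (intro diag2_orth S(1)) (auto intro: orthI)
    have TT: "T\<^sup>T = diag2 (1\<^sub>m d) S\<^sup>T" unfolding T_def using S' by (simp add: diag2_transpose[of _ d _ e])
    have "diag2 ?R B' = T * diag2 ?R A' * T\<^sup>T"
      unfolding TT unfolding T_def S(2) using S' A' R'
      by (simp add: diag2_mult[of _ d _ e] mult_carrier_mat[of _ e e _ e])
    moreover have "diag2 ?R A' = Q\<^sup>T * A * Q"
      unfolding QA(4) using diag2_carrier[OF R'(1) A'(1)] d(1)
      by (intro orth_conj_cancel[OF QA(2), symmetric]) simp
    ultimately have "B = P * (T * (Q\<^sup>T * A * Q) * T\<^sup>T) * P\<^sup>T" using PB(3) by simp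
    also have "\<dots> = (P * T * Q\<^sup>T) * A * (P * T * Q\<^sup>T)\<^sup>T"
      using orthD(1)[OF QA(2)] orthD(1)[OF PB(1)] orthD(1)[OF T] A(1)
      by (simp add: transpose_mult[of _ N N _ N] assoc_mult_mat[of _ N N _ N _ N] mult_carrier_mat[of _ N N _ N])
    finally show ?thesis
      using QA(2) PB(1) T orthD(4)[OF QA(2)] by (intro bexI[of _ "P * T * Q\<^sup>T"] orth_mult)
  qed
qed

lemma orth_conj_iff:
  assumes "A \<in> orth N" "B \<in> orth N"
  shows "(\<exists>Q\<in>orth N. B = Q * A * Q\<^sup>T) \<longleftrightarrow> complex_char_poly A = complex_char_poly B"
  using orth_conj_if_char_poly_eq[OF assms] complex_char_poly_conj[OF _ orthD(1)[OF assms(1)]] by auto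

section \<open>Conjugacy classes of torsion elements\<close>

lemma inv_orth:
  assumes "Q \<in> orth N"
  shows "inv\<^bsub>orthogonal_group N\<^esub> Q = Q\<^sup>T"
  using orthD[OF assms] assms
  by (intro monoid.inv_char[OF group.is_monoid[OF group_orthogonal_group]]) auto

lemma orth_pow:
  assumes "A \<in> orth N"
  shows "A [^]\<^bsub>orthogonal_group N\<^esub> m = A ^\<^sub>m m"
proof (induction m)
  case 0
  interpret group "orthogonal_group N" by (rule group_orthogonal_group)
  show ?case using orthD(1)[OF assms] by simp
next
  case (Suc m)
  interpret group "orthogonal_group N" by (rule group_orthogonal_group)
  show ?case using Suc by simp
qed

definition torsion :: "nat \<Rightarrow> nat \<Rightarrow> real mat set" where
  "torsion N m = {A \<in> orth N. A ^\<^sub>m m = 1\<^sub>m N}"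

lemma pow_mat_conj:
  assumes "Q \<in> orth N" "A \<in> carrier_mat N N"
  shows "(Q * A * Q\<^sup>T) ^\<^sub>m m = Q * A ^\<^sub>m m * Q\<^sup>T"
  using assms orthD[OF assms(1)]
  by (intro similar_mat_wit_pow_id similar_mat_witI[of _ _ N]) (auto simp: mult_carrier_mat[of _ N N _ N])

lemma torsion_conj_iff:
  assumes Q: "Q \<in> orth N" and A: "A \<in> orth N"
  shows "Q * A * Q\<^sup>T \<in> torsion N m \<longleftrightarrow> A \<in> torsion N m"
proof -
  note Q' = orthD[OF Q] and A' = orthD(1)[OF A]
  have "A ^\<^sub>m m = Q\<^sup>T * (Q * A ^\<^sub>m m * Q\<^sup>T) * Q"
    using A' by (intro orth_conj_cancel[OF Q, symmetric]) auto
  moreover have "Q\<^sup>T * 1\<^sub>m N * Q = 1\<^sub>m N" "Q * 1\<^sub>m N * Q\<^sup>T = 1\<^sub>m N" using Q' by auto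
  ultimately have "Q * A ^\<^sub>m m * Q\<^sup>T = 1\<^sub>m N \<longleftrightarrow> A ^\<^sub>m m = 1\<^sub>m N" by metis
  then show ?thesis
    using orth_mult[OF orth_mult[OF Q A] Q'(4)] A by (simp add: torsion_def pow_mat_conj[OF Q A'])
qed

lemma conjugacy_classes_orth:
  "conjugacy_classes (orthogonal_group N) = (\<lambda>A. {Q * A * Q\<^sup>T | Q. Q \<in> orth N}) ` orth N"
proof -
  have "orbit (orthogonal_group N) (\<lambda>g. \<lambda>h\<in>orth N. g * h * inv\<^bsub>orthogonal_group N\<^esub> g) A
      = {Q * A * Q\<^sup>T | Q. Q \<in> orth N}" if "A \<in> orth N" for A
    using that unfolding orbit_def by (auto simp: inv_orth) (metis inv_orth)
  then show ?thesis unfolding conjugacy_classes_def orbits_def by auto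
qed

text \<open>Two maps with the same fibres have images in bijection, whether finite or not. This
  exchanges conjugacy classes for characteristic polynomials.\<close>

lemma card_image_eq_if:
  assumes "\<And>x y. x \<in> A \<Longrightarrow> y \<in> A \<Longrightarrow> f x = f y \<longleftrightarrow> g x = g y"
  shows "card (f ` A) = card (g ` A)"
proof -
  have "bij_betw (\<lambda>u. f (SOME x. x \<in> A \<and> g x = u)) (g ` A) (f ` A)"
  proof -
    have *: "(SOME x'. x' \<in> A \<and> g x' = g x) \<in> A \<and> g (SOME x'. x' \<in> A \<and> g x' = g x) = g x"
      if "x \<in> A" for x
      using someI[of "\<lambda>x'. x' \<in> A \<and> g x' = g x" x] that by simp
    then have "f (SOME x'. x' \<in> A \<and> g x' = g x) = f x" if "x \<in> A" for x
      using that assms by blast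
    then show ?thesis using assms by (auto simp: bij_betw_def inj_on_def image_image)
  qed
  then show ?thesis by (metis bij_betw_same_card)
qed

text \<open>Torsion is invariant under conjugation, so a class consists of torsion elements as soon
  as one representative is torsion; and the characteristic polynomial is a complete invariant of
  classes.\<close>

lemma num_conjugacy_classes_orth:
  "num_conjugacy_classes (orthogonal_group N) m = card (complex_char_poly ` torsion N m)"
proof -
  define cl where "cl A = {Q * A * Q\<^sup>T | Q. Q \<in> orth N}" for A
  have one: "1\<^sub>m N \<in> orth N" by (auto intro: orthI)
  have self: "A \<in> cl A" if "A \<in> orth N" for A
    using that orthD(1)[OF that] by (auto simp: cl_def intro!: exI[of _ "1\<^sub>m N"] one)
  have sub: "cl A \<subseteq> torsion N m \<longleftrightarrow> A \<in> torsion N m" if "A \<in> orth N" for A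
    using self[OF that] torsion_conj_iff[OF _ that] by (auto simp: cl_def)
  have tor: "{x \<in> orth N. x [^]\<^bsub>orthogonal_group N\<^esub> m = \<one>\<^bsub>orthogonal_group N\<^esub>} = torsion N m"
    by (auto simp: torsion_def orth_pow)
  have "{C \<in> conjugacy_classes (orthogonal_group N). C \<subseteq> torsion N m} = cl ` torsion N m"
    using sub unfolding conjugacy_classes_orth cl_def[symmetric] by (auto simp: torsion_def)
  then have "num_conjugacy_classes (orthogonal_group N) m = card (cl ` torsion N m)"
    unfolding num_conjugacy_classes_def tor by simp
  moreover have "cl A = cl B \<longleftrightarrow> complex_char_poly A = complex_char_poly B"
    if AB: "A \<in> orth N" "B \<in> orth N" for A B
  proof
    assume "cl A = cl B"
    then have "B \<in> cl A" using self[OF AB(2)] by simp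
    then show "complex_char_poly A = complex_char_poly B"
      using orth_conj_iff[OF AB] by (auto simp: cl_def)
  next
    have sub: "cl B \<subseteq> cl A" if AB: "A \<in> orth N" "B \<in> orth N" "complex_char_poly A = complex_char_poly B" for A B
    proof -
      obtain P where P: "P \<in> orth N" "B = P * A * P\<^sup>T" using orth_conj_if_char_poly_eq[OF AB] by blast
      have "Q * B * Q\<^sup>T = (Q * P) * A * (Q * P)\<^sup>T" if "Q \<in> orth N" for Q
        using orthD(1)[OF that] orthD(1)[OF P(1)] orthD(1)[OF \<open>A \<in> orth N\<close>] unfolding P(2)
        by (simp add: transpose_mult[of _ N N _ N] assoc_mult_mat[of _ N N _ N _ N] mult_carrier_mat[of _ N N _ N])
      then show ?thesis using orth_mult[OF _ P(1)] by (auto simp: cl_def)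
    qed
    assume "complex_char_poly A = complex_char_poly B"
    then show "cl A = cl B" using sub AB by (metis subset_antisym)
  qed
  then have "card (cl ` torsion N m) = card (complex_char_poly ` torsion N m)"
    by (intro card_image_eq_if) (auto simp only: torsion_def mem_Collect_eq)
  ultimately show ?thesis by simp
qed

section \<open>Counting characteristic polynomials\<close>

text \<open>For \<open>j \<le> k\<close> these are the roots of unity of order dividing
  \<open>2 * k\<close> in the closed upper half plane, one from each conjugate pair.\<close>

definition angle :: "nat \<Rightarrow> nat \<Rightarrow> complex" where
  "angle k j = cis (pi * real j / real k)"

definition root_pair :: "nat \<Rightarrow> nat \<Rightarrow> complex poly" where
  "root_pair k j = [:- angle k j, 1:] * [:- cnj (angle k j), 1:]"

definition pair_prod :: "nat \<Rightarrow> (nat \<Rightarrow> nat) \<Rightarrow> complex poly" where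
  "pair_prod k c = (\<Prod>j\<le>k. root_pair k j ^ c j)"

text \<open>Serves to record one more rotation block, and later to absorb even powers of the two
  real linear factors.\<close>

lemma pair_prod_add:
  assumes "i \<le> k"
  shows "pair_prod k (c(i := c i + d)) = root_pair k i ^ d * pair_prod k c"
    "(\<Sum>j\<le>k. (c(i := c i + d)) j) = d + (\<Sum>j\<le>k. c j)"
proof -
  have "pair_prod k (c(i := c i + d)) = root_pair k i ^ (c i + d) *
      (\<Prod>j\<in>{..k} - {i}. root_pair k j ^ (c(i := c i + d)) j)"
    unfolding pair_prod_def using assms by (subst prod.remove[of _ i]) auto
  also have "(\<Prod>j\<in>{..k} - {i}. root_pair k j ^ (c(i := c i + d)) j) = (\<Prod>j\<in>{..k} - {i}. root_pair k j ^ c j)"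
    by (intro prod.cong) auto
  finally show "pair_prod k (c(i := c i + d)) = root_pair k i ^ d * pair_prod k c"
    unfolding pair_prod_def using assms
    by (subst (2) prod.remove[of _ i]) (auto simp: power_add mult_ac)
  have "(\<Sum>j\<in>{..k} - {i}. (c(i := c i + d)) j) = (\<Sum>j\<in>{..k} - {i}. c j)"
    by (intro sum.cong) auto
  then show "(\<Sum>j\<le>k. (c(i := c i + d)) j) = d + (\<Sum>j\<le>k. c j)"
    using assms by (simp add: sum.remove[of "{..k}" i])
qed

text \<open>The cosine is injective on the interval from 0 to pi, so real parts already separate the
  angles. A conjugate can agree only where the sine vanishes, that is, at the two ends.\<close>

lemma angle_eq_iff:
  assumes "k > 0" "i \<le> k" "j \<le> k"
  shows "angle k j = angle k i \<longleftrightarrow> j = i"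
    "cnj (angle k j) = angle k i \<longleftrightarrow> j = i \<and> (i = 0 \<or> i = k)"
proof -
  have rng: "0 \<le> pi * real i / real k" "pi * real i / real k \<le> pi" if "i \<le> k" for i
    using that assms(1) by (auto simp: field_simps)
  have cos: "cos (pi * real j / real k) = cos (pi * real i / real k) \<longleftrightarrow> j = i"
    using cos_inj_pi[of "pi * real j / real k" "pi * real i / real k"] rng assms by auto
  then show "angle k j = angle k i \<longleftrightarrow> j = i"
    by (auto simp: angle_def complex_eq_iff)
  have "sin (pi * real i / real k) = 0 \<longleftrightarrow> i = 0 \<or> i = k"
  proof
    assume s: "sin (pi * real i / real k) = 0"
    show "i = 0 \<or> i = k"
    proof (rule ccontr)
      assume "\<not> ?thesis"
      then have "0 < pi * real i / real k" "pi * real i / real k < pi"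
        using assms by (auto simp: field_simps)
      then show False using sin_gt_zero s by fastforce
    qed
  qed (use assms in auto)
  then show "cnj (angle k j) = angle k i \<longleftrightarrow> j = i \<and> (i = 0 \<or> i = k)"
    using cos by (auto simp: angle_def complex_eq_iff)
qed

lemma angle_ends: "k > 0 \<Longrightarrow> angle k 0 = 1" "k > 0 \<Longrightarrow> angle k k = -1"
  by (simp_all add: angle_def)

lemma root_pair_ends:
  "k > 0 \<Longrightarrow> root_pair k 0 = [:-1, 1:]\<^sup>2" "k > 0 \<Longrightarrow> root_pair k k = [:1, 1:]\<^sup>2"
  by (simp_all add: root_pair_def angle_ends power2_eq_square)

text \<open>A root with index \<open>j > k\<close> is the conjugate of the one with index
  \<open>2 * k - j\<close>, and the quadratic factor is symmetric under conjugation.\<close>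

lemma root_unity_pair:
  assumes "k > 0" "z ^ (2 * k) = 1"
  obtains j where "j \<le> k" "[:- z, 1:] * [:- cnj z, 1:] = root_pair k j"
proof -
  have "z \<in> (\<lambda>j. cis (2 * pi * real j / real (2 * k))) ` {..<2 * k}"
    using bij_betw_roots_unity[of "2 * k"] assms by (auto simp: bij_betw_def)
  then obtain j where j: "j < 2 * k" "z = angle k j"
    using assms by (auto simp: angle_def)
  show thesis
  proof (cases "j \<le> k")
    case True
    then show ?thesis using j by (intro that[of j]) (auto simp: root_pair_def)
  next
    case False
    have "pi * real (2 * k - j) / real k = 2 * pi - pi * real j / real k"
      using j assms by (simp add: of_nat_diff field_simps)
    then have "angle k (2 * k - j) = cnj z"
      unfolding angle_def j(2) by (simp add: complex_eq_iff)
    then show ?thesis using False j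
      by (intro that[of "2 * k - j"]) (auto simp: root_pair_def mult.commute simp del: mult_pCons_left mult_pCons_right)
  qed
qed

lemma pow_eq_one_root:
  assumes A: "A \<in> carrier_mat N N" "A ^\<^sub>m m = 1\<^sub>m N" and z: "poly (complex_char_poly A) z = 0"
  shows "z ^ m = 1"
proof -
  let ?C = "map_mat complex_of_real A"
  have C: "?C \<in> carrier_mat N N" using A by simp
  obtain v where v: "eigenvector ?C v z"
    using z A eigenvalue_root_char_poly[of ?C N z] by (auto simp: complex_char_poly_def eigenvalue_def)
  have v': "v \<in> carrier_vec N" "v \<noteq> 0\<^sub>v N" using v A by (auto simp: eigenvector_def)
  have "?C ^\<^sub>m m = map_mat complex_of_real (A ^\<^sub>m m)"
    using of_real_hom.mat_hom_pow[OF A(1), of m, where ?'a = complex] by simp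
  also have "\<dots> = 1\<^sub>m N" using A(2) by (simp add: of_real_hom.mat_hom_one)
  finally have "v = z ^ m \<cdot>\<^sub>v v" using eigenvector_pow[OF C v, of m] v' by simp
  moreover obtain i where "i < N" "v $ i \<noteq> 0" using v' by (metis carrier_vecD eq_vecI index_zero_vec)
  ultimately show ?thesis using v' by (metis carrier_vecD index_smult_vec(1) mult_cancel_right2)
qed

text \<open>Conjugation preserves torsion and powers of block diagonal matrices are taken blockwise,
  so the complement in \<open>orth_split\<close> is again torsion.\<close>

lemma torsion_split:
  assumes A: "A \<in> torsion N m" and z: "poly (complex_char_poly A) z = 0"
  obtains e B where "N = dim_row (root_block z) + e" "B \<in> torsion e m" "z ^ m = 1"
    "complex_char_poly A = complex_char_poly (root_block z) * complex_char_poly B"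
proof -
  have Ao: "A \<in> orth N" using A by (simp add: torsion_def)
  obtain Q e B where QB: "N = dim_row (root_block z) + e" "Q \<in> orth N" "B \<in> orth e"
    "A = Q * diag2 (root_block z) B * Q\<^sup>T" "root_block z \<in> orth (dim_row (root_block z))"
    by (rule orth_split[OF Ao z])
  note R = orthD(1)[OF QB(5)] and B = orthD(1)[OF QB(3)]
  have D: "diag2 (root_block z) B \<in> orth N" using diag2_orth[OF QB(5,3)] QB(1) by simp
  then have "diag2 (root_block z) B \<in> torsion N m"
    using A torsion_conj_iff[OF QB(2) D] QB(4) by simp
  then have "diag2 (root_block z ^\<^sub>m m) (B ^\<^sub>m m) = 1\<^sub>m (dim_row (root_block z) + e)"
    using QB(1) by (simp add: torsion_def diag2_pow[OF R B])
  then have "B ^\<^sub>m m = 1\<^sub>m e"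
    by (rule diag2_eq_one[OF pow_carrier_mat[OF R] pow_carrier_mat[OF B]])
  then have "B \<in> torsion e m" using QB(3) by (simp add: torsion_def)
  moreover have "z ^ m = 1" using pow_eq_one_root[OF orthD(1)[OF Ao] _ z] A by (simp add: torsion_def)
  moreover have "complex_char_poly A = complex_char_poly (root_block z) * complex_char_poly B"
    using complex_char_poly_conj[OF QB(2) orthD(1)[OF D]] complex_char_poly_diag2[OF R B] QB(4) by simp
  ultimately show thesis using that QB(1) by blast
qed

text \<open>Induction on the size, splitting off one root at a time: the roots 1 and -1 raise
  \<open>a\<close> and \<open>b\<close>, any other root raises an entry of \<open>c\<close>. The
  exponents are not normalised here, as \<open>c\<close> may also be nonzero at 0 and
  \<open>k\<close>; \<open>torsion_polys_odd\<close> does that.\<close>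

lemma torsion_char_poly:
  assumes "k > 0" "A \<in> torsion N (2 * k)"
  shows "\<exists>a b c. a + b + 2 * (\<Sum>j\<le>k. c j) = N \<and>
    complex_char_poly A = [:-1, 1:] ^ a * [:1, 1:] ^ b * pair_prod k c"
  using assms(2)
proof (induction N arbitrary: A rule: less_induct)
  case (less N)
  have A: "A \<in> carrier_mat N N" using less.prems orthD by (auto simp: torsion_def)
  show ?case
  proof (cases "N = 0")
    case True
    then have "complex_char_poly A = 1"
      using A by (auto simp: complex_char_poly_def char_poly_def intro!: det_dim_zero char_poly_matrix_closed)
    then show ?thesis using True
      by (intro exI[of _ 0] exI[of _ "\<lambda>_. 0"]) (simp add: pair_prod_def)
  next
    case False
    then have "\<not> constant (poly (complex_char_poly A))"
      using complex_char_poly_degree(1)[OF A] by (simp add: constant_degree)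
    then obtain z where z: "poly (complex_char_poly A) z = 0"
      using fundamental_theorem_of_algebra by blast
    obtain e B where B: "N = dim_row (root_block z) + e" "B \<in> torsion e (2 * k)" "z ^ (2 * k) = 1"
      "complex_char_poly A = complex_char_poly (root_block z) * complex_char_poly B"
      by (rule torsion_split[OF less.prems z])
    have "e < N" using B(1) by (auto simp: root_block_def)
    from less.IH[OF this B(2)] obtain a b c where abc: "a + b + 2 * (\<Sum>j\<le>k. c j) = e"
      "complex_char_poly B = [:-1, 1:] ^ a * [:1, 1:] ^ b * pair_prod k c" by blast
    consider "z = 1" | "z = -1" | "z\<^sup>2 \<noteq> 1" by (auto simp: power2_eq_1_iff)
    then show ?thesis
    proof cases
      case 1
      then have "Suc a + b + 2 * (\<Sum>j\<le>k. c j) = N \<and>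
          complex_char_poly A = [:-1, 1:] ^ Suc a * [:1, 1:] ^ b * pair_prod k c"
        using B abc by (simp add: complex_char_poly_root_block root_block_dim mult_ac
          del: mult_pCons_left mult_pCons_right)
      then show ?thesis by blast
    next
      case 2
      then have "a + Suc b + 2 * (\<Sum>j\<le>k. c j) = N \<and>
          complex_char_poly A = [:-1, 1:] ^ a * [:1, 1:] ^ Suc b * pair_prod k c"
        using B abc by (simp add: complex_char_poly_root_block root_block_dim mult_ac
          del: mult_pCons_left mult_pCons_right)
      then show ?thesis by blast
    next
      case 3
      obtain j where j: "j \<le> k" "[:- z, 1:] * [:- cnj z, 1:] = root_pair k j"
        using root_unity_pair[OF assms(1) B(3)] .
      have "a + b + 2 * (\<Sum>i\<le>k. (c(j := c j + 1)) i) = N \<and>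
          complex_char_poly A = [:-1, 1:] ^ a * [:1, 1:] ^ b * pair_prod k (c(j := c j + 1))"
        unfolding pair_prod_add[OF j(1)] using B abc 3 j(2)
        by (simp add: complex_char_poly_root_block root_block_dim mult_ac
          del: mult_pCons_left mult_pCons_right)
      then show ?thesis by blast
    qed
  qed
qed

section \<open>Which polynomials are realised by torsion matrices\<close>

definition torsion_polys :: "nat \<Rightarrow> nat \<Rightarrow> complex poly set" where
  "torsion_polys N m = complex_char_poly ` torsion N m"

text \<open>Block diagonal matrices realise products, so realising a polynomial reduces to realising
  its factors.\<close>

lemma torsion_polys_mult:
  assumes "p \<in> torsion_polys M m" "q \<in> torsion_polys N m"
  shows "p * q \<in> torsion_polys (M + N) m"
proof -
  obtain A B where AB: "A \<in> torsion M m" "B \<in> torsion N m" "p = complex_char_poly A" "q = complex_char_poly B"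
    using assms by (auto simp: torsion_polys_def)
  have o: "A \<in> orth M" "B \<in> orth N" using AB by (auto simp: torsion_def)
  have "diag2 A B \<in> torsion (M + N) m"
    using AB diag2_orth[OF o] diag2_pow[OF orthD(1)[OF o(1)] orthD(1)[OF o(2)], of m]
    by (simp add: torsion_def diag2_one)
  then show ?thesis
    using complex_char_poly_diag2[OF orthD(1)[OF o(1)] orthD(1)[OF o(2)]] 
    unfolding torsion_polys_def AB(3,4) by (metis imageI)
qed

lemma torsion_polys_one: "1 \<in> torsion_polys 0 m"
proof -
  have "1\<^sub>m 0 \<in> torsion 0 m" by (auto simp: torsion_def intro: orthI)
  moreover have "complex_char_poly (1\<^sub>m 0) = 1"
    by (auto simp: complex_char_poly_def char_poly_def intro!: det_dim_zero char_poly_matrix_closed)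
  ultimately show ?thesis unfolding torsion_polys_def by (metis imageI)
qed

lemma torsion_polys_power: "p \<in> torsion_polys N m \<Longrightarrow> p ^ a \<in> torsion_polys (a * N) m"
  by (induction a) (simp_all add: torsion_polys_mult torsion_polys_one)

lemma torsion_polys_prod:
  "finite I \<Longrightarrow> (\<And>i. i \<in> I \<Longrightarrow> p i \<in> torsion_polys (N i) m) \<Longrightarrow>
    prod p I \<in> torsion_polys (sum N I) m"
  by (induction I rule: finite_induct) (simp_all add: torsion_polys_mult torsion_polys_one)

lemma torsion_polys_linear:
  assumes "s\<^sup>2 = 1"
  shows "[:- of_real s, 1:] \<in> torsion_polys 1 (2 * k)"
proof -
  have pow: "(mat 1 1 (\<lambda>_. s)) ^\<^sub>m i = mat 1 1 (\<lambda>_. s ^ i)" for i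
    by (induction i) (auto simp: scalar_prod_def mult.commute intro!: eq_matI)
  have "s * s = 1" "s ^ (2 * k) = 1" using assms by (auto simp: power2_eq_square power_mult)
  then have "mat 1 1 (\<lambda>_. s) \<in> torsion 1 (2 * k)"
    by (auto simp: torsion_def pow scalar_prod_def simp del: One_nat_def intro!: orthI eq_matI)
  then show ?thesis unfolding torsion_polys_def using complex_char_poly_single by (metis imageI)
qed

lemma torsion_polys_root_pair:
  assumes "k > 0"
  shows "root_pair k j \<in> torsion_polys 2 (2 * k)"
proof -
  have "angle k j ^ (2 * k) = cis (2 * pi * real j)"
    using assms by (simp add: angle_def DeMoivre mult_ac)
  also have "\<dots> = 1" by (simp add: cis_multiple_2pi)
  finally have "angle k j ^ (2 * k) = 1" .
  then have "rot (angle k j) \<in> torsion 2 (2 * k)"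
    by (auto simp: torsion_def rot_pow rot_one intro!: rot_orth) (simp add: angle_def)
  then show ?thesis unfolding torsion_polys_def root_pair_def
    using complex_char_poly_rot by (metis imageI)
qed

text \<open>The linear factor left over in odd dimension: the flag says whether 1 or -1 is the
  eigenvalue of odd multiplicity.\<close>

definition unit_poly :: "bool \<Rightarrow> complex poly" where
  "unit_poly e = (if e then [:-1, 1:] else [:1, 1:])"

text \<open>Exactly one of the two exponents is odd, and one copy of its base is taken out.\<close>

lemma power_odd_split:
  fixes x y :: "'a :: comm_monoid_mult"
  assumes "odd (a + b)"
  shows "x ^ a * y ^ b = (if odd a then x else y) * (x ^ (2 * (a div 2)) * y ^ (2 * (b div 2)))"
proof (cases "odd a")
  case True
  then obtain i j where "a = 2 * i + 1" "b = 2 * j" using assms by (auto elim!: oddE evenE)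
  then show ?thesis by (simp add: mult_ac)
next
  case False
  then obtain i j where "a = 2 * i" "b = 2 * j + 1" using assms by (auto elim!: oddE evenE)
  then show ?thesis by (simp add: mult_ac)
qed

text \<open>A normal form for the polynomials. Exponents become lists of length \<open>Suc k\<close>
  with sum \<open>n\<close>, which stars and bars can count.\<close>

lemma torsion_polys_odd:
  assumes k: "k > 0"
  shows "torsion_polys (2 * n + 1) (2 * k)
    = (\<lambda>(e, l). unit_poly e * pair_prod k (nth l)) ` (UNIV \<times> {l. length l = Suc k \<and> sum_list l = n})"
    (is "_ = ?rhs")
proof (intro equalityI subsetI)
  fix p assume "p \<in> torsion_polys (2 * n + 1) (2 * k)"
  then obtain a b c where abc: "a + b + 2 * (\<Sum>j\<le>k. c j) = 2 * n + 1"
    "p = [:-1, 1:] ^ a * [:1, 1:] ^ b * pair_prod k c"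
    using torsion_char_poly[OF k] unfolding torsion_polys_def by blast
  \<comment> \<open>The squares of the two real linear factors are \<open>root_pair k 0\<close> and
    \<open>root_pair k k\<close>, so the even parts of \<open>a\<close> and \<open>b\<close> move
    into the exponents at the two ends.\<close>
  define c1 where "c1 = c(0 := c 0 + a div 2)"
  define c2 where "c2 = c1(k := c1 k + b div 2)"
  have c2: "pair_prod k c2 = [:1, 1:] ^ (2 * (b div 2)) * ([:-1, 1:] ^ (2 * (a div 2)) * pair_prod k c)"
    unfolding c2_def using k by (simp add: pair_prod_add c1_def root_pair_ends power_mult del: fun_upd_apply)
  have sum: "(\<Sum>j\<le>k. c2 j) = b div 2 + (a div 2 + (\<Sum>j\<le>k. c j))"
    unfolding c2_def pair_prod_add(2)[OF order_refl] unfolding c1_def pair_prod_add(2)[OF le0] ..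
  have odd: "odd (a + b)" using abc(1) by presburger
  have ab: "a + b = 2 * (a div 2) + 2 * (b div 2) + 1" using odd by presburger
  define l where "l = map c2 [0..<Suc k]"
  have "sum_list l = (\<Sum>j\<le>k. c2 j)"
    unfolding l_def by (simp add: sum_set_upt_conv_sum_list_nat[symmetric] atLeast0LessThan lessThan_Suc_atMost
      del: upt_Suc)
  also have "\<dots> = n" using sum abc(1) ab by linarith
  finally have l: "length l = Suc k" "sum_list l = n" by (auto simp: l_def)
  have ln: "pair_prod k (nth l) = pair_prod k c2"
    unfolding pair_prod_def l_def by (intro prod.cong) (auto simp del: upt_Suc)
  have "p = unit_poly (odd a) * pair_prod k (nth l)"
    unfolding ln abc(2) c2 unit_poly_def power_odd_split[OF odd]
    by (simp only: mult_ac)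
  then show "p \<in> ?rhs" using l by (intro image_eqI[of _ _ "(odd a, l)"]) auto
next
  fix p assume "p \<in> ?rhs"
  then obtain e l where l: "length l = Suc k" "sum_list l = n" "p = unit_poly e * pair_prod k (nth l)" by auto
  have "unit_poly e \<in> torsion_polys 1 (2 * k)"
    using torsion_polys_linear[of 1 k] torsion_polys_linear[of "-1" k] by (cases e) (auto simp: unit_poly_def)
  moreover have "pair_prod k (nth l) \<in> torsion_polys (\<Sum>j\<le>k. l ! j * 2) (2 * k)"
    unfolding pair_prod_def by (intro torsion_polys_prod torsion_polys_power torsion_polys_root_pair k) auto
  moreover have "(\<Sum>j\<le>k. l ! j * 2) = 2 * n"
    using l by (auto simp: sum_list_sum_nth atLeast0LessThan lessThan_Suc_atMost sum_distrib_right[symmetric])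
  ultimately show "p \<in> torsion_polys (2 * n + 1) (2 * k)"
    using torsion_polys_mult[of "unit_poly e" 1 "2 * k" "pair_prod k (nth l)" "2 * n"] l by simp
qed

section \<open>Root multiplicities and uniqueness of the exponents\<close>

lemma order_prod:
  fixes f :: "'a \<Rightarrow> 'b :: idom poly"
  assumes "finite I" "\<And>i. i \<in> I \<Longrightarrow> f i \<noteq> 0"
  shows "Polynomial.order x (prod f I) = (\<Sum>i\<in>I. Polynomial.order x (f i))"
  using assms by (induction I rule: finite_induct) (auto simp: order_mult)

lemma order_pow:
  fixes p :: "'b :: idom poly"
  assumes "p \<noteq> 0"
  shows "Polynomial.order x (p ^ a) = a * Polynomial.order x p"
  using assms by (induction a) (auto simp: order_mult)

lemma order_root_pair:
  assumes "k > 0" "i \<le> k" "j \<le> k"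
  shows "Polynomial.order (angle k i) (root_pair k j) = (if i = j then (if i = 0 \<or> i = k then 2 else 1) else 0)"
proof -
  have "Polynomial.order (angle k i) (root_pair k j)
      = (if angle k j = angle k i then 1 else 0) + (if cnj (angle k j) = angle k i then 1 else 0)"
    unfolding root_pair_def
    by (subst order_mult) (auto simp: order_linear' simp del: mult_pCons_left mult_pCons_right)
  then show ?thesis using assms by (simp add: angle_eq_iff)
qed

lemma root_pair_nonzero: "root_pair k j \<noteq> 0"
  by (simp add: root_pair_def del: mult_pCons_left mult_pCons_right)

text \<open>Among the quadratic factors only the one with index \<open>i\<close> vanishes at
  \<open>angle k i\<close>, doubly at the two ends where its roots coincide; the linear factor adds
  one at a single end.\<close>

lemma order_pair_prod:
  assumes "k > 0" "i \<le> k"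
  shows "Polynomial.order (angle k i) (unit_poly e * pair_prod k c)
    = (if i = (if e then 0 else k) then 1 else 0) + c i * (if i = 0 \<or> i = k then 2 else 1)"
proof -
  have "Polynomial.order (angle k i) (pair_prod k c)
      = (\<Sum>j\<le>k. c j * (if i = j then (if i = 0 \<or> i = k then 2 else 1) else 0))"
    unfolding pair_prod_def using assms
    by (simp add: order_prod root_pair_nonzero order_pow order_root_pair)
  also have "\<dots> = (\<Sum>j\<le>k. if j = i then c i * (if i = 0 \<or> i = k then 2 else 1) else 0)"
    by (intro sum.cong) auto
  also have "\<dots> = c i * (if i = 0 \<or> i = k then 2 else 1)" using assms by simp
  finally have 1: "Polynomial.order (angle k i) (pair_prod k c) = c i * (if i = 0 \<or> i = k then 2 else 1)" .
  have "unit_poly e = [:- angle k (if e then 0 else k), 1:]"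
    using assms by (auto simp: unit_poly_def angle_ends)
  then have 2: "Polynomial.order (angle k i) (unit_poly e) = (if i = (if e then 0 else k) then 1 else 0)"
    using assms angle_eq_iff(1)[of k "if e then 0 else k" i] by (auto simp: order_linear')
  have "unit_poly e * pair_prod k c \<noteq> 0"
    by (auto simp: unit_poly_def pair_prod_def root_pair_nonzero simp del: mult_pCons_left mult_pCons_right)
  then show ?thesis using 1 2 by (simp add: order_mult)
qed

text \<open>The multiplicities at the points \<open>angle k i\<close> recover first the flag and
  then every exponent.\<close>

lemma pair_prod_inj:
  assumes "k > 0"
  shows "inj_on (\<lambda>(e, l). unit_poly e * pair_prod k (nth l)) (UNIV \<times> {l. length l = Suc k \<and> sum_list l = n})"
proof (rule inj_onI, clarify)
  fix e l e' l'
  assume l: "length l = Suc k" "length l' = Suc k" 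
    and eq: "unit_poly e * pair_prod k (nth l) = unit_poly e' * pair_prod k (nth l')"
  have o: "(if i = (if e then 0 else k) then 1 else 0) + l ! i * (if i = 0 \<or> i = k then 2 else 1)
      = (if i = (if e' then 0 else k) then 1 else 0) + l' ! i * (if i = 0 \<or> i = k then 2 else 1)"
    if "i \<le> k" for i
    using order_pair_prod[OF assms that, of e "nth l"] order_pair_prod[OF assms that, of e' "nth l'"] eq by metis
  \<comment> \<open>The multiplicity of the root 1 is twice an exponent, plus one exactly when the
    flag is set, so its parity decides the flag.\<close>
  have e: "e = e'" using o[of 0] assms by (auto split: if_splits) presburger+
  have "l ! i = l' ! i" if "i \<le> k" for i using o[OF that] e by (auto split: if_splits)
  then show "e = e' \<and> l = l'" using e l by (auto intro: nth_equalityI)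
qed

theorem theorem16:
  fixes n m :: nat
  assumes "n > 0" and "m > 0" and "even m"
  shows "num_conjugacy_classes (orthogonal_group (2 * n + 1)) m
           = 2 * ((n + m div 2) choose (m div 2))"
proof -
  define k where "k = m div 2"
  have k: "k > 0" "m = 2 * k" using assms by (auto simp: k_def elim: evenE)
  have "num_conjugacy_classes (orthogonal_group (2 * n + 1)) m = card (torsion_polys (2 * n + 1) m)"
    by (simp add: num_conjugacy_classes_orth torsion_polys_def)
  also have "\<dots> = card ((UNIV :: bool set) \<times> {l :: nat list. length l = Suc k \<and> sum_list l = n})"
    unfolding k(2) torsion_polys_odd[OF k(1)] by (rule card_image[OF pair_prod_inj[OF k(1)]])
  \<comment> \<open>Stars and bars for \<open>k + 1\<close> exponents with sum \<open>n\<close>; the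
    factor 2 counts the flag.\<close>
  also have "\<dots> = 2 * ((n + k) choose n)"
    by (simp add: card_cartesian_product card_length_sum_list)
  also have "(n + k) choose n = (n + k) choose k"
    using binomial_symmetric[of n "n + k"] by simp
  finally show ?thesis by (simp add: k_def)
qed

end
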